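(* Let $G$ be a connected chain graph and let $P^*$ be an optimal path cover of $G$. Then $\mathrm{Opt}(G)\ge |E(P^* )|-2$.
   Context: A chain graph is a bipartite graph $G=(X,Y,E)$ whose vertices of $X$ can be ordered $x_1,\dots,x_{n_1}$ with $N(x_1)\subseteq N(x_2)\subseteq\dots\subseteq N(x_{n_1})$. A path cover of $G$ is a spanning subgraph every component of which is a path; an optimal path cover is a path cover with the maximum number of edges, and $|E(P^* )|$ is its number of edges. $\mathrm{Opt}(G)$ denotes the maximum, over all spanning trees $T$ of $G$, of the number of vertices of degree at least $2$ in $T$. *)

theory Defs
  imports Main
begin

(* A finite simple graph is given by its vertex set V and its set E of two-element edges.
   A spanning subgraph of (V, E) is determined by its edge set F, a subset of E. *)

definition adjacent :: "'a set set \<Rightarrow> 'a \<Rightarrow> 'a \<Rightarrow> bool" where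
  "adjacent E u v \<longleftrightarrow> {u, v} \<in> E"

definition neighbourhood :: "'a set set \<Rightarrow> 'a \<Rightarrow> 'a set" where
  "neighbourhood E v = {w. adjacent E v w}"

definition vertex_degree :: "'a set set \<Rightarrow> 'a \<Rightarrow> nat" where
  "vertex_degree E v = card {e \<in> E. v \<in> e}"

definition connected_graph :: "'a set \<Rightarrow> 'a set set \<Rightarrow> bool" where
  "connected_graph V E \<longleftrightarrow> V \<noteq> {} \<and> (\<forall>u \<in> V. \<forall>v \<in> V. (adjacent E)\<^sup>*\<^sup>* u v)"

definition graph_components :: "'a set \<Rightarrow> 'a set set \<Rightarrow> ('a set \<times> 'a set set) set" where
  "graph_components V E =
     {(C, {e \<in> E. e \<subseteq> C}) | C. \<exists>u \<in> V. C = {v \<in> V. (adjacent E)\<^sup>*\<^sup>* u v}}"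

(* A single vertex without edges counts as a path. *)
definition path_graph :: "'a set \<Rightarrow> 'a set set \<Rightarrow> bool" where
  "path_graph V E \<longleftrightarrow>
     (\<exists>vs. vs \<noteq> [] \<and> distinct vs \<and> set vs = V \<and>
           E = {{vs ! i, vs ! Suc i} | i. Suc i < length vs})"

definition cycle_in :: "'a set set \<Rightarrow> 'a list \<Rightarrow> bool" where
  "cycle_in E vs \<longleftrightarrow>
     length vs \<ge> 3 \<and> distinct vs \<and> successively (adjacent E) vs \<and> adjacent E (last vs) (hd vs)"

definition tree_graph :: "'a set \<Rightarrow> 'a set set \<Rightarrow> bool" where
  "tree_graph V E \<longleftrightarrow> connected_graph V E \<and> (\<nexists>vs. cycle_in E vs)"

definition spanning_tree_of :: "'a set \<Rightarrow> 'a set set \<Rightarrow> 'a set set \<Rightarrow> bool" where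
  "spanning_tree_of V E T \<longleftrightarrow> T \<subseteq> E \<and> tree_graph V T"

(* Meaningful for finite connected graphs, where the set below is finite and nonempty. *)
definition Opt :: "'a set \<Rightarrow> 'a set set \<Rightarrow> nat" where
  "Opt V E = Max {card {v \<in> V. vertex_degree T v \<ge> 2} | T. spanning_tree_of V E T}"

definition path_cover :: "'a set \<Rightarrow> 'a set set \<Rightarrow> 'a set set \<Rightarrow> bool" where
  "path_cover V E P \<longleftrightarrow> P \<subseteq> E \<and> (\<forall>(C, F) \<in> graph_components V P. path_graph C F)"

definition optimal_path_cover :: "'a set \<Rightarrow> 'a set set \<Rightarrow> 'a set set \<Rightarrow> bool" where
  "optimal_path_cover V E P \<longleftrightarrow>
     path_cover V E P \<and> (\<forall>Q. path_cover V E Q \<longrightarrow> card Q \<le> card P)"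

definition bipartite_graph :: "'a set \<Rightarrow> 'a set \<Rightarrow> 'a set set \<Rightarrow> bool" where
  "bipartite_graph X Y E \<longleftrightarrow>
     finite X \<and> finite Y \<and> X \<inter> Y = {} \<and> E \<subseteq> {{x, y} | x y. x \<in> X \<and> y \<in> Y}"

definition chain_graph :: "'a set \<Rightarrow> 'a set \<Rightarrow> 'a set set \<Rightarrow> bool" where
  "chain_graph X Y E \<longleftrightarrow>
     bipartite_graph X Y E \<and>
     (\<exists>xs. distinct xs \<and> set xs = X \<and>
           sorted_wrt (\<lambda>x x'. neighbourhood E x \<subseteq> neighbourhood E x') xs)"

end

(* In a connected chain graph some a in X is adjacent to all of Y and some b in Y to all of X.
   Orient every path of the cover and join its last vertex to a or b (whichever lies on the other
   side), except for the at most two paths containing a or b.  The result is acyclic, so it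
   extends to a spanning tree; in it every vertex that is not the first one of its path, apart
   from the last vertices of those two paths, has degree at least 2.  The vertices that are not
   first on their path are as many as the edges of the cover. *)

theory Submission
  imports Defs
begin

section \<open>Reachability and rotation of cycles\<close>

lemma adjacent_sym: "adjacent E u v \<Longrightarrow> adjacent E v u"
  by (simp add: adjacent_def insert_commute)

lemma reachable_sym: "(adjacent E)\<^sup>*\<^sup>* u v \<Longrightarrow> (adjacent E)\<^sup>*\<^sup>* v u"
  by (metis adjacent_sym sympD sympI symp_rtranclp)

lemma successively_reachable:
  "successively R xs \<Longrightarrow> x \<in> set xs \<Longrightarrow> R\<^sup>*\<^sup>* (hd xs) x"
proof (induction xs rule: induct_list012)
  case (3 u v xs)
  then show ?case
    by (auto intro: converse_rtranclp_into_rtranclp)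
qed auto

lemma cycle_in_rotate1: "cycle_in E (v # vs) \<Longrightarrow> cycle_in E (vs @ [v])"
  using successively_append_iff[of "adjacent E" vs "[v]"]
  by (cases vs) (auto simp: cycle_in_def)

lemma cycle_in_rotate:
  assumes "cycle_in E (xs @ ys)"
  shows "cycle_in E (ys @ xs)"
  using assms
proof (induction xs arbitrary: ys)
  case (Cons x xs)
  from Cons.IH[of "ys @ [x]"] cycle_in_rotate1[of E x "xs @ ys"] Cons.prems show ?case
    by simp
qed simp

text \<open>Lets a proof choose where a cycle begins: the two neighbours of the chosen vertex then
  are the second and the last entry of the list.\<close>

lemma cycle_in_start_at:
  assumes "cycle_in E c" "v \<in> set c"
  obtains c' where "cycle_in E (v # c')" "set (v # c') = set c"
proof -
  from assms(2) obtain ys zs where "c = ys @ v # zs"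
    by (meson split_list)
  with assms(1) cycle_in_rotate[of E ys "v # zs"] that[of "zs @ ys"] show thesis
    by auto
qed

section \<open>Acyclic edge sets: added edges, spanning trees, path covers\<close>

lemma successively_insert_edge:
  assumes "successively (adjacent (insert e F)) xs" "\<not> e \<subseteq> set xs"
  shows "successively (adjacent F) xs"
  using assms(1)
  by (rule successively_mono) (use assms(2) in \<open>auto simp: adjacent_def\<close>)

text \<open>A cycle missing \<open>u\<close> or \<open>v\<close> would already lie in
  \<open>F\<close>. Otherwise \<open>u\<close> and \<open>v\<close> cut it into two arcs, at least
  one of which has an interior vertex; that arc is a walk between \<open>u\<close> and
  \<open>v\<close> in \<open>F\<close>.\<close>

lemma cycle_free_insert:
  assumes "\<nexists>c. cycle_in F c" "\<not> (adjacent F)\<^sup>*\<^sup>* u v"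
  shows "\<nexists>c. cycle_in (insert {u, v} F) c"
proof
  let ?A = "adjacent (insert {u, v} F)"
  assume "\<exists>c. cycle_in (insert {u, v} F) c"
  then obtain c where c: "cycle_in (insert {u, v} F) c" by blast
  have uv: "u \<in> set c \<and> v \<in> set c"
  proof (rule ccontr)
    assume *: "\<not> ?thesis"
    from c have "c \<noteq> []" by (auto simp: cycle_in_def)
    then have "hd c \<in> set c" "last c \<in> set c" by auto
    with * c have "adjacent F (last c) (hd c)"
      by (auto simp: cycle_in_def adjacent_def doubleton_eq_iff)
    moreover have "successively (adjacent F) c"
      using successively_insert_edge[of "{u, v}" F c] c * by (auto simp: cycle_in_def)
    ultimately have "cycle_in F c" using c by (auto simp: cycle_in_def)
    with assms(1) show False by blast
  qed
  then obtain c' where c': "cycle_in (insert {u, v} F) (u # c')" "set (u # c') = set c"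
    using cycle_in_start_at[OF c] by blast
  have "u \<noteq> v" using assms(2) by auto
  with c' uv obtain ys zs where c'_eq: "c' = ys @ v # zs"
    by (metis set_ConsD split_list)
  have dist: "distinct (u # ys @ v # zs)" and succ: "successively ?A (u # ys @ v # zs)"
    and close: "?A (last (v # zs)) u" and len: "length ys + length zs \<ge> 1"
    using c'(1) unfolding cycle_in_def c'_eq by auto
  show False
  \<comment> \<open>If \<open>ys\<close> is nonempty, the arc through \<open>ys\<close> avoids the
    new edge: \<open>u # ys\<close> misses \<open>v\<close>, and the final step into
    \<open>v\<close> does not start at \<open>u\<close>.\<close>
  proof (cases "ys = []")
    case False
    have "successively ?A ((u # ys) @ v # zs)" using succ by simp
    then have 1: "successively ?A (u # ys)" "?A (last ys) v"
      using False unfolding successively_append_iff by auto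
    then have "successively (adjacent F) (u # ys)"
      using successively_insert_edge[of "{u, v}" F "u # ys"] dist by auto
    then have "(adjacent F)\<^sup>*\<^sup>* u (last ys)"
      using successively_reachable[of "adjacent F" "u # ys" "last ys"] False by auto
    moreover have "last ys \<noteq> u" using False dist by (auto dest: last_in_set)
    with 1(2) \<open>u \<noteq> v\<close> have "adjacent F (last ys) v"
      by (auto simp: adjacent_def doubleton_eq_iff)
    ultimately show False using assms(2) by (meson rtranclp.rtrancl_into_rtrancl)
  next
    case True
    \<comment> \<open>The first arc is now the single step from \<open>u\<close> to
      \<open>v\<close>. A cycle has at least three vertices, so the returning arc through
      \<open>zs\<close> has an interior vertex.\<close>
    with len have zs: "zs \<noteq> []" by auto
    have "successively ?A ([u] @ v # zs)" using succ True by simp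
    then have "successively ?A (v # zs)" unfolding successively_append_iff by auto
    then have "successively (adjacent F) (v # zs)"
      using successively_insert_edge[of "{u, v}" F "v # zs"] dist by auto
    then have "(adjacent F)\<^sup>*\<^sup>* v (last zs)"
      using successively_reachable[of "adjacent F" "v # zs" "last zs"] zs by auto
    moreover have "last zs \<noteq> v" using zs dist by (auto dest: last_in_set)
    with close zs \<open>u \<noteq> v\<close> have "adjacent F (last zs) u"
      by (auto simp: adjacent_def doubleton_eq_iff)
    ultimately have "(adjacent F)\<^sup>*\<^sup>* v u" by (meson rtranclp.rtrancl_into_rtrancl)
    with assms(2) reachable_sym show False by metis
  qed
qed

text \<open>Take \<open>T\<close> maximal among the acyclic edge sets between \<open>F\<close> and
  \<open>E\<close>. By \<open>cycle_free_insert\<close>, an edge of \<open>E\<close> between two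
  components of \<open>T\<close> could still be added, so \<open>T\<close> connects whatever
  \<open>E\<close> connects.\<close>

lemma cycle_free_extends_to_spanning_tree:
  assumes "finite E" "connected_graph V E" "F \<subseteq> E" "\<nexists>c. cycle_in F c"
  obtains T where "F \<subseteq> T" "spanning_tree_of V E T"
proof -
  let ?A = "{T. F \<subseteq> T \<and> T \<subseteq> E \<and> (\<nexists>c. cycle_in T c)}"
  have "finite ?A" by (rule finite_subset[of _ "Pow E"]) (use assms(1) in auto)
  moreover have "F \<in> ?A" using assms by auto
  ultimately obtain T where T: "T \<in> ?A" and max: "\<And>T'. T' \<in> ?A \<Longrightarrow> T \<subseteq> T' \<Longrightarrow> T' = T"
    by (metis (no_types, lifting) finite_has_maximal2)
  have step: "(adjacent T)\<^sup>*\<^sup>* x y" if "adjacent E x y" for x y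
  proof (rule ccontr)
    assume n: "\<not> (adjacent T)\<^sup>*\<^sup>* x y"
    with T that have "insert {x, y} T \<in> ?A"
      using cycle_free_insert[of T x y] by (auto simp: adjacent_def)
    with max have "{x, y} \<in> T" by blast
    with n show False by (auto simp: adjacent_def)
  qed
  have "(adjacent T)\<^sup>*\<^sup>* x y" if "(adjacent E)\<^sup>*\<^sup>* x y" for x y
    using that by induction (auto intro: rtranclp_trans step)
  with T assms(2) have "spanning_tree_of V E T"
    by (auto simp: spanning_tree_of_def tree_graph_def connected_graph_def)
  with T that show thesis by blast
qed

text \<open>A component of \<open>F\<close> that meets \<open>S\<close> has only one vertex in
  \<open>S\<close> and contains no target \<open>h t\<close>. So when the edge at \<open>s\<close>
  is added, the component of \<open>s\<close> is still its component in \<open>F\<close>, and the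
  edge leads out of it.\<close>

lemma cycle_free_attach:
  assumes "finite S" "\<nexists>c. cycle_in F c"
    and "\<And>s t. s \<in> S \<Longrightarrow> t \<in> S \<Longrightarrow> (adjacent F)\<^sup>*\<^sup>* s t \<Longrightarrow> s = t"
    and "\<And>s t. s \<in> S \<Longrightarrow> t \<in> S \<Longrightarrow> \<not> (adjacent F)\<^sup>*\<^sup>* s (h t)"
  shows "\<nexists>c. cycle_in (F \<union> (\<lambda>s. {s, h s}) ` S) c"
  using assms
proof (induction S)
  case (insert s S)
  let ?F = "F \<union> (\<lambda>s. {s, h s}) ` S"
  \<comment> \<open>Edges added earlier do not enlarge what \<open>s\<close> reaches: using one
    would require reaching some \<open>t\<close> in \<open>S\<close> other than \<open>s\<close>, or
    some \<open>h t\<close>, inside \<open>F\<close>.\<close>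
  have "(adjacent F)\<^sup>*\<^sup>* s w" if "(adjacent ?F)\<^sup>*\<^sup>* s w" for w
    using that
  proof induction
    case (step w w')
    consider "adjacent F w w'" | t where "t \<in> S" "{w, w'} = {t, h t}"
      using step.hyps(2) by (auto simp: adjacent_def)
    then show ?case
    proof cases
      case 1
      with step.IH show ?thesis by (meson rtranclp.rtrancl_into_rtrancl)
    next
      case 2
      with step.IH insert.prems(2)[of s t] insert.prems(3)[of s t] insert.hyps show ?thesis
        by (auto simp: doubleton_eq_iff)
    qed
  qed simp
  with insert.prems(3)[of s s] have "\<not> (adjacent ?F)\<^sup>*\<^sup>* s (h s)" by blast
  moreover have "\<nexists>c. cycle_in ?F c"
    using insert.IH insert.prems by simp
  ultimately show ?case
    using cycle_free_insert[of ?F s "h s"] by simp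
qed simp

(* The vertex of a cycle that comes last on the path would have two neighbours preceding it. *)
lemma path_graph_cycle_free:
  assumes "path_graph C F"
  shows "\<nexists>c. cycle_in F c"
proof
  from assms obtain vs where vs: "distinct vs"
    and F: "F = {{vs ! i, vs ! Suc i} | i. Suc i < length vs}"
    by (auto simp: path_graph_def)
  have adj: "\<exists>i j. i < length vs \<and> j < length vs \<and> u = vs ! i \<and> w = vs ! j \<and>
      (j = Suc i \<or> i = Suc j)" if "adjacent F u w" for u w
    using that unfolding F adjacent_def doubleton_eq_iff mem_Collect_eq
    by (metis Suc_lessD)
  assume "\<exists>c. cycle_in F c"
  then obtain c where c: "cycle_in F c" by blast
  then have "c \<noteq> []" "set c \<subseteq> set vs"
  proof -
    show "c \<noteq> []" using c by (auto simp: cycle_in_def)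
    show "set c \<subseteq> set vs"
    proof
      fix v assume "v \<in> set c"
      with c obtain c' where c': "cycle_in F (v # c')" by (rule cycle_in_start_at)
      then have "adjacent F (last (v # c')) v" by (simp add: cycle_in_def)
      with adj show "v \<in> set vs" by (metis nth_mem)
    qed
  qed
  define I where "I = {i. i < length vs \<and> vs ! i \<in> set c}"
  have "finite I" by (simp add: I_def)
  have "hd c \<in> set vs" "hd c \<in> set c" using \<open>c \<noteq> []\<close> \<open>set c \<subseteq> set vs\<close> by auto
  then obtain i where "i < length vs" "vs ! i = hd c" by (metis in_set_conv_nth)
  with \<open>hd c \<in> set c\<close> have "I \<noteq> {}" by (auto simp: I_def)
  define m where "m = Max I"
  have "m \<in> I" and m_max: "\<And>i. i \<in> I \<Longrightarrow> i \<le> m"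
    using \<open>finite I\<close> \<open>I \<noteq> {}\<close> by (auto simp: m_def)
  then have "m < length vs" "vs ! m \<in> set c" by (auto simp: I_def)
  have prev: "0 < m \<and> w = vs ! (m - 1)" if "adjacent F (vs ! m) w" "w \<in> set c" for w
  proof -
    from adj[OF that(1)] obtain i j where ij: "i < length vs" "j < length vs"
      "vs ! m = vs ! i" "w = vs ! j" "j = Suc i \<or> i = Suc j" by blast
    then have "i = m" using vs \<open>m < length vs\<close> by (simp add: nth_eq_iff_index_eq)
    moreover have "j \<le> m" using m_max that(2) ij by (auto simp: I_def)
    ultimately show ?thesis using ij by auto
  qed
  obtain c' where c': "cycle_in F (vs ! m # c')" "set (vs ! m # c') = set c"
    using cycle_in_start_at[OF c \<open>vs ! m \<in> set c\<close>] by blast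
  \<comment> \<open>Length at least 3 makes the second and the last entry different vertices,
    whereas \<open>prev\<close> equates both with \<open>vs ! (m - 1)\<close>.\<close>
  then obtain x d y where "c' = x # d @ [y]"
    by (cases c' rule: list.exhaust; cases "tl c'" rule: rev_exhaust) (auto simp: cycle_in_def)
  with c' have "adjacent F (vs ! m) x" "adjacent F y (vs ! m)" "x \<noteq> y" "x \<in> set c" "y \<in> set c"
    by (auto simp: cycle_in_def)
  with prev[of x] prev[of y] adjacent_sym[of F y] show False by auto
qed

text \<open>A cycle is connected, so it stays inside one component of \<open>P\<close>, which is a
  path. Edges lying within \<open>V\<close> put its vertices into such a component.\<close>

lemma path_cover_cycle_free:
  assumes "path_cover V E P" "\<And>e. e \<in> P \<Longrightarrow> e \<subseteq> V"
  shows "\<nexists>c. cycle_in P c"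
proof
  assume "\<exists>c. cycle_in P c"
  then obtain c where c: "cycle_in P c" by blast
  define C where "C = {v \<in> V. (adjacent P)\<^sup>*\<^sup>* (hd c) v}"
  have nonempty: "c \<noteq> []" using c by (auto simp: cycle_in_def)
  have edge_V: "x \<in> V" "y \<in> V" if "adjacent P x y" for x y
    using that assms(2) by (auto simp: adjacent_def)
  have "set c \<subseteq> C"
  proof
    fix v assume v: "v \<in> set c"
    then obtain c' where "cycle_in P (v # c')" using cycle_in_start_at c by metis
    then have "v \<in> V" using edge_V by (auto simp: cycle_in_def)
    moreover have "(adjacent P)\<^sup>*\<^sup>* (hd c) v"
      using successively_reachable v c by (auto simp: cycle_in_def)
    ultimately show "v \<in> C" by (simp add: C_def)
  qed
  with nonempty have "hd c \<in> V" by (auto simp: C_def dest: hd_in_set)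
  then have "(C, {e \<in> P. e \<subseteq> C}) \<in> graph_components V P"
    by (auto simp: graph_components_def C_def)
  with assms(1) have "path_graph C {e \<in> P. e \<subseteq> C}" by (auto simp: path_cover_def)
  moreover have "cycle_in {e \<in> P. e \<subseteq> C} c"
  proof -
    have "successively (adjacent {e \<in> P. e \<subseteq> C}) c"
      by (rule successively_mono[of "adjacent P"])
        (use c \<open>set c \<subseteq> C\<close> in \<open>auto simp: cycle_in_def adjacent_def\<close>)
    moreover have "hd c \<in> C" "last c \<in> C" using nonempty \<open>set c \<subseteq> C\<close> by auto
    ultimately show ?thesis using c by (auto simp: cycle_in_def adjacent_def)
  qed
  ultimately show False using path_graph_cycle_free by blast
qed

section \<open>Counting the vertices of degree at least 2\<close>

lemma two_le_vertex_degree: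
  assumes "finite T" "e \<in> T" "e' \<in> T" "e \<noteq> e'" "v \<in> e" "v \<in> e'"
  shows "vertex_degree T v \<ge> 2"
proof -
  have "card {e, e'} \<le> card {e \<in> T. v \<in> e}"
    by (rule card_mono) (use assms in auto)
  with assms(4) show ?thesis by (simp add: vertex_degree_def)
qed

lemma card_le_Opt:
  assumes "finite E" "spanning_tree_of V E T"
  shows "card {v \<in> V. vertex_degree T v \<ge> 2} \<le> Opt V E"
proof -
  have "finite {T. spanning_tree_of V E T}"
    by (rule finite_subset[of _ "Pow E"]) (use assms(1) in \<open>auto simp: spanning_tree_of_def\<close>)
  then show ?thesis
    unfolding Opt_def by (intro Max_ge) (use assms(2) in auto)
qed

text \<open>Any choice of partners is injective. The relational form allows edges to be counted by
  their later endpoints without first defining a map.\<close>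

lemma card_le_related:
  assumes "finite B" "\<And>x. x \<in> A \<Longrightarrow> \<exists>y\<in>B. R x y"
    and "\<And>x x' y. R x y \<Longrightarrow> R x' y \<Longrightarrow> x = x'"
  shows "card A \<le> card B"
proof -
  from assms(2) obtain f where f: "\<And>x. x \<in> A \<Longrightarrow> f x \<in> B \<and> R x (f x)" by metis
  then have "inj_on f A" using assms(3) by (metis inj_onI)
  with f assms(1) show ?thesis by (intro card_inj_on_le[of f]) auto
qed

text \<open>The chain structure enters through \<open>a\<close> and \<open>b\<close>, which offer
  every path end an edge to one of them. The loss of 2 accounts for the ends of the paths through
  \<open>a\<close> and \<open>b\<close>, which may stay leaves.\<close>

lemma dominating_vertices_imp_Opt_ge:
  assumes fin: "finite V" "finite E" and EV: "\<And>e. e \<in> E \<Longrightarrow> \<exists>u\<in>V. \<exists>v\<in>V. e = {u, v}"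
    and conn: "connected_graph V E" and cover: "path_cover V E P"
    and dom: "\<And>v. v \<in> V \<Longrightarrow> {v, a} \<in> E \<or> {v, b} \<in> E"
  shows "card P \<le> Opt V E + 2"
proof -
  let ?R = "(adjacent P)\<^sup>*\<^sup>*"
  have PE: "P \<subseteq> E" using cover by (simp add: path_cover_def)
  with EV have PV: "\<And>e. e \<in> P \<Longrightarrow> e \<subseteq> V" by blast
  define comp where "comp v = {w \<in> V. ?R v w}" for v
  have comp_eq: "comp v = comp w" if "?R v w" for v w
    using that reachable_sym[OF that] unfolding comp_def by (auto intro: rtranclp_trans)
  define path_of where "path_of C vs \<longleftrightarrow> vs \<noteq> [] \<and> distinct vs \<and> set vs = C \<and>
      {e \<in> P. e \<subseteq> C} = {{vs ! i, vs ! Suc i} | i. Suc i < length vs}" for C vs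
  have ex_path: "\<exists>vs. path_of (comp v) vs" if "v \<in> V" for v
  proof -
    have "(comp v, {e \<in> P. e \<subseteq> comp v}) \<in> graph_components V P"
      using that by (auto simp: graph_components_def comp_def)
    with cover have "path_graph (comp v) {e \<in> P. e \<subseteq> comp v}" by (auto simp: path_cover_def)
    then show ?thesis by (simp add: path_graph_def path_of_def)
  qed
  \<comment> \<open>The choice depends on \<open>v\<close> only through \<open>comp v\<close>, so
    all vertices of a component share one list. This fixes an orientation of each path.\<close>
  define l where "l v = (SOME vs. path_of (comp v) vs)" for v
  have path: "path_of (comp v) (l v)" if "v \<in> V" for v
    unfolding l_def by (rule someI_ex) (rule ex_path[OF that])
  have l: "l v \<noteq> []" "distinct (l v)" "set (l v) = comp v"
      "{e \<in> P. e \<subseteq> comp v} = {{l v ! i, l v ! Suc i} | i. Suc i < length (l v)}"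
    if "v \<in> V" for v
    using path[OF that] unfolding path_of_def by simp_all
  have l_edge_iff: "e \<in> P \<and> e \<subseteq> comp v \<longleftrightarrow> (\<exists>i. e = {l v ! i, l v ! Suc i} \<and> Suc i < length (l v))"
    if "v \<in> V" for e v
    using arg_cong[OF l(4)[OF that], of "(\<in>) e"] by (simp only: mem_Collect_eq)
  have l_eq: "l v = l w" if "?R v w" for v w
    using comp_eq[OF that] by (simp add: l_def)

  \<comment> \<open>Pairs an edge of the cover with its later endpoint. A vertex occurs once in its
    list and so has at most one predecessor, whence no vertex is paired with two edges.\<close>
  define nonhead where "nonhead e v \<longleftrightarrow> v \<in> V \<and>
      (\<exists>i. Suc i < length (l v) \<and> v = l v ! Suc i \<and> e = {l v ! i, l v ! Suc i})" for e v
  define N where "N = {v. \<exists>e. nonhead e v}"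
  have "finite N" by (rule finite_subset[OF _ fin(1)]) (auto simp: N_def nonhead_def)
  have "card P \<le> card N"
  proof (rule card_le_related[OF \<open>finite N\<close>, where R = nonhead])
    fix e assume "e \<in> P"
    with PE EV obtain u w where u: "u \<in> V" "w \<in> V" "e = {u, w}" by blast
    with \<open>e \<in> P\<close> have "e \<subseteq> comp u" by (auto simp: comp_def adjacent_def)
    with \<open>e \<in> P\<close> obtain i where i: "Suc i < length (l u)" "e = {l u ! i, l u ! Suc i}"
      using l_edge_iff[OF u(1)] by metis
    define v where "v = l u ! Suc i"
    have "v \<in> comp u" using nth_mem[OF i(1)] unfolding l(3)[OF u(1)] v_def .
    then have "v \<in> V" "l v = l u" using l_eq[of u v] by (simp_all add: comp_def)
    with i have "nonhead e v" unfolding nonhead_def v_def by metis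
    then show "\<exists>v\<in>N. nonhead e v" by (auto simp: N_def)
  next
    fix e e' v assume "nonhead e v" "nonhead e' v"
    then obtain i j where ij: "v \<in> V" "Suc i < length (l v)" "l v ! Suc i = v"
      "e = {l v ! i, l v ! Suc i}" "Suc j < length (l v)" "l v ! Suc j = v"
      "e' = {l v ! j, l v ! Suc j}" by (auto simp: nonhead_def)
    then have "Suc i = Suc j" using l(2)[of v] nth_eq_iff_index_eq by metis
    with ij show "e = e'" by simp
  qed

  \<comment> \<open>The path ends that receive a new edge. Leaving out the paths through
    \<open>a\<close> and \<open>b\<close> keeps every target \<open>h v\<close> outside the
    components that meet \<open>S\<close>, as \<open>cycle_free_attach\<close> demands.\<close>
  define S where "S = {v \<in> V. v = last (l v) \<and> \<not> ?R v a \<and> \<not> ?R v b}"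
  define h where "h v = (if {v, a} \<in> E then a else b)" for v
  have h_edge: "{v, h v} \<in> E" if "v \<in> V" for v
    using dom[OF that] by (auto simp: h_def)
  have "\<nexists>c. cycle_in (P \<union> (\<lambda>s. {s, h s}) ` S) c"
  proof (rule cycle_free_attach)
    show "finite S" using fin(1) by (simp add: S_def)
    show "\<nexists>c. cycle_in P c" using path_cover_cycle_free[OF cover PV] .
    \<comment> \<open>Both are the last entry of the list shared by their component.\<close>
    show "s = t" if "s \<in> S" "t \<in> S" "?R s t" for s t
      using that l_eq[of s t] unfolding S_def by simp
    show "\<not> ?R s (h t)" if "s \<in> S" "t \<in> S" for s t
      using that by (auto simp: S_def h_def)
  qed
  moreover have "P \<union> (\<lambda>s. {s, h s}) ` S \<subseteq> E"
    using PE h_edge by (auto simp: S_def)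
  ultimately obtain T where T: "P \<union> (\<lambda>s. {s, h s}) ` S \<subseteq> T" "spanning_tree_of V E T"
    using cycle_free_extends_to_spanning_tree[OF fin(2) conn] by metis
  have "finite T" using T(2) fin(2) by (auto simp: spanning_tree_of_def intro: finite_subset)

  have "N - {last (l a), last (l b)} \<subseteq> {v \<in> V. vertex_degree T v \<ge> 2}"
  proof
    fix v assume v: "v \<in> N - {last (l a), last (l b)}"
    then obtain i where i: "v \<in> V" "Suc i < length (l v)" "l v ! Suc i = v"
      by (auto simp: N_def nonhead_def)
    have l_edge: "{l v ! j, l v ! Suc j} \<in> P" if "Suc j < length (l v)" for j
      using l_edge_iff[OF i(1)] that by metis
    have l_comp: "l v ! j \<in> comp v" if "j < length (l v)" for j
      using nth_mem[OF that] unfolding l(3)[OF i(1)] .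
    have pred: "{l v ! i, v} \<in> T" using l_edge[of i] i T(1) by auto
    have "vertex_degree T v \<ge> 2"
    proof (cases "Suc (Suc i) < length (l v)")
      case True
      have "{v, l v ! Suc (Suc i)} \<in> T" using l_edge[OF True] i T(1) by auto
      moreover have "l v ! i \<noteq> l v ! Suc (Suc i)"
        using l(2)[OF i(1)] True by (simp add: nth_eq_iff_index_eq)
      ultimately show ?thesis
        using pred \<open>finite T\<close>
        by (intro two_le_vertex_degree[of T "{l v ! i, v}" "{v, l v ! Suc (Suc i)}"])
          (auto simp: doubleton_eq_iff)
    next
      case False
      then have "length (l v) = Suc (Suc i)" using i(2) by simp
      then have "v = last (l v)" using i(3) l(1)[OF i(1)] by (simp add: last_conv_nth)
      \<comment> \<open>If \<open>v\<close> reached \<open>a\<close>, the lists \<open>l v\<close>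
        and \<open>l a\<close> would agree and \<open>v\<close> would be the excluded vertex
        \<open>last (l a)\<close>; likewise for \<open>b\<close>.\<close>
      with v have "\<not> ?R v a" "\<not> ?R v b" using l_eq by auto
      with \<open>v = last (l v)\<close> i(1) have "v \<in> S" by (simp add: S_def)
      then have "{v, h v} \<in> T" using T(1) by auto
      \<comment> \<open>The target lies in another component than the predecessor of
        \<open>v\<close>, so the new edge and the edge to the predecessor are distinct.\<close>
      moreover have "\<not> ?R v (h v)"
        using \<open>\<not> ?R v a\<close> \<open>\<not> ?R v b\<close> by (simp add: h_def)
      then have "l v ! i \<noteq> h v"
        using l_comp[of i] i(2) by (auto simp: comp_def)
      ultimately show ?thesis
        using pred \<open>finite T\<close>
        by (intro two_le_vertex_degree[of T "{l v ! i, v}" "{v, h v}"])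
          (auto simp: doubleton_eq_iff)
    qed
    with i(1) show "v \<in> {v \<in> V. vertex_degree T v \<ge> 2}" by simp
  qed
  then have "card (N - {last (l a), last (l b)}) \<le> card {v \<in> V. vertex_degree T v \<ge> 2}"
    using fin(1) by (intro card_mono) auto
  also have "\<dots> \<le> Opt V E" by (rule card_le_Opt[OF fin(2) T(2)])
  finally have "card (N - {last (l a), last (l b)}) \<le> Opt V E" .
  moreover have "card N - card {last (l a), last (l b)} \<le> card (N - {last (l a), last (l b)})"
    by (rule diff_card_le_card_Diff) simp
  \<comment> \<open>The two ends coincide if \<open>a\<close> and \<open>b\<close> lie on the same
    path, hence only an upper bound.\<close>
  moreover have "card {last (l a), last (l b)} \<le> 2"
    by (simp add: card_insert_if)
  ultimately show ?thesis using \<open>card P \<le> card N\<close> by linarith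
qed

section \<open>The dominating pair of a connected chain graph\<close>

lemma connected_graph_neighbour:
  assumes "connected_graph V E" "u \<in> V" "v \<in> V" "u \<noteq> v"
  obtains w where "adjacent E u w"
  using assms unfolding connected_graph_def by (metis converse_rtranclpE)

text \<open>By connectivity the smallest neighbourhood, that of \<open>hd xs\<close>, contains some
  \<open>b\<close>, which then lies in all the others. Each \<open>y\<close> has a neighbour in
  \<open>X\<close>, whose neighbourhood is contained in that of \<open>last xs\<close>; so
  \<open>last xs\<close> serves as \<open>a\<close>.\<close>

lemma connected_chain_graph_dominating:
  assumes chain: "chain_graph X Y E" and conn: "connected_graph (X \<union> Y) E"
    and ne: "X \<noteq> {}" "Y \<noteq> {}"
  obtains a b where "\<And>y. y \<in> Y \<Longrightarrow> {y, a} \<in> E" "\<And>x. x \<in> X \<Longrightarrow> {x, b} \<in> E"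
proof -
  from chain obtain xs where xs: "set xs = X"
    and sorted: "sorted_wrt (\<lambda>x x'. neighbourhood E x \<subseteq> neighbourhood E x') xs"
    and bip: "X \<inter> Y = {}" "E \<subseteq> {{x, y} | x y. x \<in> X \<and> y \<in> Y}"
    by (auto simp: chain_graph_def bipartite_graph_def)
  have "xs \<noteq> []" using xs ne(1) by auto
  have first: "neighbourhood E (hd xs) \<subseteq> neighbourhood E x" if "x \<in> X" for x
    using sorted that xs \<open>xs \<noteq> []\<close> by (cases xs) auto
  have final: "neighbourhood E x \<subseteq> neighbourhood E (last xs)" if "x \<in> X" for x
    using sorted that xs \<open>xs \<noteq> []\<close>
    by (cases xs rule: rev_cases) (auto simp: sorted_wrt_append)
  \<comment> \<open>A second vertex, different from \<open>hd xs\<close>, is what forces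
    \<open>hd xs\<close> to have a neighbour.\<close>
  from ne(2) obtain y0 where "y0 \<in> Y" by blast
  moreover have "hd xs \<in> X" using xs \<open>xs \<noteq> []\<close> by auto
  ultimately obtain b where "adjacent E (hd xs) b"
    using connected_graph_neighbour[OF conn, of "hd xs" y0] bip(1) by blast
  with first have "{x, b} \<in> E" if "x \<in> X" for x
    using that by (auto simp: neighbourhood_def adjacent_def)
  moreover have "{y, last xs} \<in> E" if y: "y \<in> Y" for y
  proof -
    obtain x where "adjacent E y x"
      using connected_graph_neighbour[OF conn, of y "hd xs"] y \<open>hd xs \<in> X\<close> bip(1) by blast
    moreover from this obtain x' y' where "{y, x} = {x', y'}" "x' \<in> X" "y' \<in> Y"
      using bip(2) by (auto simp: adjacent_def)
    then have "x \<in> X" using bip(1) y by (auto simp: doubleton_eq_iff)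
    ultimately have "y \<in> neighbourhood E (last xs)"
      using final adjacent_sym[of E y x] by (auto simp: neighbourhood_def)
    then show ?thesis by (simp add: neighbourhood_def adjacent_def insert_commute)
  qed
  ultimately show thesis using that by blast
qed

theorem theorem5:
  fixes X Y :: "'a set" and E P :: "'a set set"
  assumes "chain_graph X Y E"
    and "connected_graph (X \<union> Y) E"
    and "optimal_path_cover (X \<union> Y) E P"
  shows "int (Opt (X \<union> Y) E) \<ge> int (card P) - 2"
proof (cases "P = {}")
  case False
  have cover: "path_cover (X \<union> Y) E P"
    using assms(3) by (simp add: optimal_path_cover_def)
  have fin: "finite (X \<union> Y)" and sub: "E \<subseteq> {{x, y} | x y. x \<in> X \<and> y \<in> Y}"
    using assms(1) by (auto simp: chain_graph_def bipartite_graph_def)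
  then have EV: "\<And>e. e \<in> E \<Longrightarrow> \<exists>u\<in>X \<union> Y. \<exists>v\<in>X \<union> Y. e = {u, v}" by blast
  then have "E \<subseteq> Pow (X \<union> Y)" by blast
  then have "finite E" using fin by (meson finite_Pow_iff finite_subset)
  \<comment> \<open>An edge makes both sides nonempty and so rules out the one-vertex graph, which
    has no dominating pair. For empty \<open>P\<close> the integer bound is negative.\<close>
  have "E \<noteq> {}" using False cover by (auto simp: path_cover_def)
  with sub have "X \<noteq> {}" "Y \<noteq> {}" by auto
  then obtain a b where "\<And>y. y \<in> Y \<Longrightarrow> {y, a} \<in> E" "\<And>x. x \<in> X \<Longrightarrow> {x, b} \<in> E"
    using connected_chain_graph_dominating[OF assms(1,2)] by metis
  then have "card P \<le> Opt (X \<union> Y) E + 2"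
    using dominating_vertices_imp_Opt_ge[OF fin \<open>finite E\<close> EV assms(2) cover] by blast
  then show ?thesis by linarith
qed simp

end
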